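(* Let $(X,d)$ be a metric space with subexponential asymptotic dimension growth, i.e. such that its asymptotic dimension function $\mathrm{ad}_X\colon[0,+\infty)\to\mathbb{Z}\cup\{+\infty\}$ has subexponential growth. Then $X$ has Yu's property $A$: there is a net $(\zeta^n)_n$ of functions $\zeta^n\colon X\to\ell_1(X)$, $x\mapsto\zeta^n_x$, such that (1) $\zeta^n_x\ge 0$ and $\|\zeta^n_x\|=1$ for all $n$ and all $x\in X$; (2) for every $n$ there is $S_n>0$ such that $\operatorname{supp}\zeta^n_x\subset B(x,S_n)$ for all $x\in X$; (3) for every $R>0$, $\lim_n\sup\{\|\zeta^n_x-\zeta^n_y\| : x,y\in X,\ d(x,y)\le R\}=0$.
   Context: Let $(X,d)$ be a metric space (no bounded geometry, countability or discreteness is assumed). $B(x,S)=\{y\in X: d(x,y)\le S\}$ denotes the closed ball with center $x$ and radius $S$. $\ell_1(X)$ is the space of absolutely summable real (or complex) valued functions on the set $X$ with its norm $\|f\|=\sum_{z\in X}|f(z)|$, and $\operatorname{supp} f=\{z\in X: f(z)\ne 0\}$. A net is a family indexed by a (nonempty) directed set, and $\lim_n$ is the limit along the net. Let $\mathcal{U}$ be a cover of $X$ by subsets of $X$. - $\mathcal{U}$ is uniformly bounded if the diameters of the elements of $\mathcal{U}$ are uniformly bounded, i.e. $\sup_{U\in\mathcal{U}}\operatorname{diam}(U)<\infty$. - The Lebesgue number $L(\mathcal{U})\in[0,+\infty]$ is the supremum of those $\lambda\ge 0$ such that every subset $B\subset X$ of diameter at most $\lambda$ is contained in some element of $\mathcal{U}$.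 - The multiplicity $m(\mathcal{U})$ is the maximal number of elements of $\mathcal{U}$ with a nonempty intersection ($+\infty$ if there is no finite maximum). The asymptotic dimension function of $X$ is the extended integer valued function defined for $\lambda\in[0,+\infty)$ by $$\mathrm{ad}_X(\lambda)=\min\{m(\mathcal{U}) : \mathcal{U}\text{ is a uniformly bounded cover of }X\text{ with }L(\mathcal{U})\ge\lambda\}-1,$$ with value $+\infty$ if there is no such cover of finite multiplicity. The function $\mathrm{ad}_X$ has subexponential growth if $\mathrm{ad}_X(\lambda)<\infty$ for all $\lambda$ and $\lim_{\lambda\to\infty}\frac{1}{\lambda}\log(\mathrm{ad}_X(\lambda)+1)=0$. *)

theory Defs
  imports "HOL-Analysis.Analysis"
begin

section \<open>The asymptotic dimension function\<close>

text \<open>A metric space is a set \<open>X\<close> in a type of class \<^class>\<open>metric_space\<close>, with the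
  restricted distance.\<close>

text \<open>On unbounded sets the library's \<^const>\<open>diameter\<close> is not meaningful, so an upper bound on
  the diameter is always combined with \<^const>\<open>bounded\<close>.\<close>

definition unif_bounded_cover :: "'a::metric_space set \<Rightarrow> 'a set set \<Rightarrow> bool" where
  "unif_bounded_cover X \<U> \<longleftrightarrow>
     (\<forall>U\<in>\<U>. U \<subseteq> X) \<and> \<Union>\<U> = X \<and>
     (\<forall>U\<in>\<U>. bounded U) \<and> bdd_above (diameter ` \<U>)"

definition lebesgue_number :: "'a::metric_space set \<Rightarrow> 'a set set \<Rightarrow> ennreal" where
  "lebesgue_number X \<U> =
     Sup {ennreal t | t. t \<ge> 0 \<and>
            (\<forall>B. B \<subseteq> X \<and> bounded B \<and> diameter B \<le> t \<longrightarrow> (\<exists>U\<in>\<U>. B \<subseteq> U))}"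

text \<open>It suffices to count finite subfamilies: an infinite subfamily with nonempty intersection
  has finite ones of every size, and then the supremum in \<^typ>\<open>enat\<close> is infinite.\<close>

definition multiplicity_cover :: "'a set set \<Rightarrow> enat" where
  "multiplicity_cover \<U> = Sup {enat (card \<V>) | \<V>. \<V> \<subseteq> \<U> \<and> finite \<V> \<and> \<Inter>\<V> \<noteq> {}}"

text \<open>The infimum in \<^typ>\<open>enat\<close> is a minimum when the set is nonempty, and \<open>\<infinity>\<close> for the empty
  set. The subtraction takes place in \<^typ>\<open>ereal\<close>, so that it is not truncated.\<close>

definition asdim_fun :: "'a::metric_space set \<Rightarrow> real \<Rightarrow> ereal" where
  "asdim_fun X t =
     ereal_of_enat (Inf {multiplicity_cover \<U> | \<U>.
        unif_bounded_cover X \<U> \<and> lebesgue_number X \<U> \<ge> ennreal t}) - 1"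

definition subexponential_growth :: "(real \<Rightarrow> ereal) \<Rightarrow> bool" where
  "subexponential_growth f \<longleftrightarrow>
     (\<forall>t\<ge>0. f t < \<infinity>) \<and>
     ((\<lambda>t. 1 / t * ln (real_of_ereal (f t) + 1)) \<longlongrightarrow> 0) at_top"


section \<open>Nets and property A\<close>

definition directed_by :: "'i set \<Rightarrow> 'i rel \<Rightarrow> bool" where
  "directed_by I r \<longleftrightarrow>
     I \<noteq> {} \<and> preorder_on I r \<and> (\<forall>i\<in>I. \<forall>j\<in>I. \<exists>k\<in>I. (i, k) \<in> r \<and> (j, k) \<in> r)"

text \<open>The filter generated by the tails of the directed set \<open>I\<close>; convergence along this filter
  is convergence of nets.\<close>

definition net_filter :: "'i set \<Rightarrow> 'i rel \<Rightarrow> 'i filter" where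
  "net_filter I r = (INF i\<in>I. principal {j\<in>I. (i, j) \<in> r})"

lemma eventually_net_filter:
  assumes "directed_by I r"
  shows "eventually P (net_filter I r) \<longleftrightarrow> (\<exists>i\<in>I. \<forall>j\<in>I. (i, j) \<in> r \<longrightarrow> P j)"
proof -
  have tr: "trans r"
    using assms by (simp add: directed_by_def preorder_on_def)
  have "\<exists>k\<in>I. principal {l\<in>I. (k, l) \<in> r}
          \<le> inf (principal {l\<in>I. (i, l) \<in> r}) (principal {l\<in>I. (j, l) \<in> r})"
    if ij: "i \<in> I" "j \<in> I" for i j
  proof -
    obtain k where "k \<in> I" "(i, k) \<in> r" "(j, k) \<in> r"
      using assms ij unfolding directed_by_def by blast
    with transD[OF tr] show ?thesis
      by (intro bexI[of _ k]) auto
  qed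
  moreover have "I \<noteq> {}"
    using assms by (simp add: directed_by_def)
  ultimately show ?thesis
    unfolding net_filter_def
    by (subst eventually_INF_base) (auto simp: eventually_principal)
qed

definition l1_space :: "'a set \<Rightarrow> ('a \<Rightarrow> real) set" where
  "l1_space X = {f. (\<lambda>z. \<bar>f z\<bar>) summable_on X}"

definition l1_norm :: "'a set \<Rightarrow> ('a \<Rightarrow> real) \<Rightarrow> real" where
  "l1_norm X f = (\<Sum>\<^sub>\<infinity>z\<in>X. \<bar>f z\<bar>)"

definition property_A_net ::
    "'a::metric_space set \<Rightarrow> 'i set \<Rightarrow> 'i rel \<Rightarrow> ('i \<Rightarrow> 'a \<Rightarrow> 'a \<Rightarrow> real) \<Rightarrow> bool" where
  "property_A_net X I r \<zeta> \<longleftrightarrow>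
     directed_by I r \<and>
     (\<forall>n\<in>I. \<forall>x\<in>X. \<zeta> n x \<in> l1_space X) \<and>
     (\<forall>n\<in>I. \<forall>x\<in>X. (\<forall>z\<in>X. \<zeta> n x z \<ge> 0) \<and> l1_norm X (\<zeta> n x) = 1) \<and>
     (\<forall>n\<in>I. \<exists>S>0. \<forall>x\<in>X. {z\<in>X. \<zeta> n x z \<noteq> 0} \<subseteq> cball x S) \<and>
     (\<forall>R>0. ((\<lambda>n. Sup {ennreal (l1_norm X (\<lambda>z. \<zeta> n x z - \<zeta> n y z)) | x y.
                          x \<in> X \<and> y \<in> X \<and> dist x y \<le> R}) \<longlongrightarrow> 0) (net_filter I r))"

text \<open>One cannot quantify existentially over the type of the index set, so the directed set is
  taken inside \<^typ>\<open>nat\<close>. This loses no generality: by the lemma \<open>property_A_if_net\<close> below, a net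
  over a directed set of any type yields one of this kind.\<close>

definition property_A :: "'a::metric_space set \<Rightarrow> bool" where
  "property_A X \<longleftrightarrow> (\<exists>(I::nat set) r \<zeta>. property_A_net X I r \<zeta>)"

lemma property_A_if_net:
  fixes I :: "'i set"
  assumes A: "property_A_net X I r \<zeta>"
  shows "property_A X"
proof -
  define D where "D n R = Sup {ennreal (l1_norm X (\<lambda>z. \<zeta> n x z - \<zeta> n y z)) | x y.
                          x \<in> X \<and> y \<in> X \<and> dist x y \<le> R}" for n R
  have dir: "directed_by I r"
    using A by (simp add: property_A_net_def)
  have lim: "((\<lambda>n. D n R) \<longlongrightarrow> 0) (net_filter I r)" if "R > 0" for R
    using A that by (simp add: property_A_net_def D_def)
  have "\<exists>i\<in>I. D i (real (Suc n)) < ennreal (1 / real (Suc n))" for n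
  proof -
    have "eventually (\<lambda>i. D i (real (Suc n)) < ennreal (1 / real (Suc n))) (net_filter I r)"
      by (rule order_tendstoD[OF lim]) auto
    then obtain i where "i \<in> I" "\<forall>j\<in>I. (i, j) \<in> r \<longrightarrow> D j (real (Suc n)) < ennreal (1 / real (Suc n))"
      unfolding eventually_net_filter[OF dir] by blast
    moreover from this dir have "(i, i) \<in> r"
      by (auto simp: directed_by_def preorder_on_def refl_on_def)
    ultimately show ?thesis by blast
  qed
  then obtain s where sI: "\<And>n. s n \<in> I"
    and sD: "\<And>n. D (s n) (real (Suc n)) < ennreal (1 / real (Suc n))"
    by metis
  define le where "le = {(m, n). m \<le> (n::nat)}"
  have dir': "directed_by UNIV le"
    unfolding directed_by_def preorder_on_def le_def refl_on_def trans_def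
    by (auto intro: max.cobounded1 max.cobounded2)
  have ev: "eventually P (net_filter UNIV le) \<longleftrightarrow> eventually P sequentially" for P
    unfolding eventually_net_filter[OF dir'] by (simp add: le_def eventually_sequentially)
  have nf: "net_filter UNIV le = sequentially"
    by (rule filter_eqI) (rule ev)
  have "((\<lambda>n. D (s n) R) \<longlonglongrightarrow> 0)" for R
  proof (rule tendsto_sandwich[of "\<lambda>_. 0"])
    show "eventually (\<lambda>n. D (s n) R \<le> ennreal (1 / real (Suc n))) sequentially"
    proof -
      obtain N where N: "R \<le> real N"
        using real_arch_simple by blast
      have "D (s n) R \<le> ennreal (1 / real (Suc n))" if "n \<ge> N" for n
      proof -
        have "R \<le> real (Suc n)"
          using N that by simp
        then have "D (s n) R \<le> D (s n) (real (Suc n))"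
          unfolding D_def by (intro Sup_subset_mono) force
        with sD[of n] show ?thesis by simp
      qed
      then show ?thesis
        unfolding eventually_sequentially by blast
    qed
    have "(\<lambda>n. 1 / real (Suc n)) \<longlonglongrightarrow> 0"
      using LIMSEQ_inverse_real_of_nat by (simp add: inverse_eq_divide)
    then show "(\<lambda>n. ennreal (1 / real (Suc n))) \<longlonglongrightarrow> 0"
      using tendsto_ennrealI[of _ 0] by fastforce
  qed auto
  then have "property_A_net X UNIV le (\<lambda>n. \<zeta> (s n))"
    using A sI dir' unfolding property_A_net_def nf D_def by blast
  then show ?thesis
    unfolding property_A_def by blast
qed

end

theory Submission
  imports Defs
begin

text \<open>
  Fix a uniformly bounded cover \<open>\<U>\<close> of \<open>X\<close> with finite multiplicity \<open>m\<close> and Lebesgue number above \<open>6 * n\<close>, and mark a point in each member. For a point \<open>x\<close> and a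
  radius \<open>\<rho> \<le> 3 * n\<close> let \<open>H x \<rho>\<close> be the set of marked points of those members that contain the
  whole ball of radius \<open>\<rho>\<close> around \<open>x\<close>. These sets are nonempty because of the Lebesgue number, have
  at most \<open>m\<close> points because all the members involved contain \<open>x\<close>, shrink as \<open>\<rho>\<close> grows, and
  satisfy \<open>H x (\<rho> + r) \<subseteq> H y \<rho>\<close> whenever \<open>dist x y \<le> r\<close>, by the triangle inequality
  (lemma \<open>marked_points_shift\<close>).

  The function \<open>\<zeta> x\<close> is the average over \<open>n \<le> \<rho> < 2 * n\<close> of the uniform distributions on
  \<open>H x \<rho>\<close>. Its support is as close to \<open>x\<close> as the members of \<open>\<U>\<close> are small, because a point of
  \<open>H x \<rho>\<close> shares a member with \<open>x\<close>. For \<open>dist x y \<le> r \<le> n\<close> the sets \<open>H x \<rho>\<close> and \<open>H y \<rho>\<close> both lie between \<open>H x (\<rho> + r)\<close> and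
  \<open>H x (\<rho> - r)\<close>, so their uniform distributions differ in norm by at most
  \<open>2 * ln (card (H x (\<rho> - r)) / card (H x (\<rho> + r)))\<close> (lemma \<open>uniform_weight_diff_le_ln\<close>). A single
  one of these logarithms may be large, but their sum over \<open>\<rho>\<close> telescopes: only \<open>2 * r\<close> terms,
  each at most \<open>ln m\<close>, survive. Hence \<open>\<zeta> x\<close> and \<open>\<zeta> y\<close> differ by at most \<open>4 * r * ln m / n\<close>
  (lemma \<open>averaged_weight_diff_le\<close>), and the growth hypothesis says that \<open>ln m / n\<close> tends to \<open>0\<close>
  for optimal covers. Only the logarithm of the multiplicity enters the estimate, and this is what
  brings subexponential, and not just sublinear, growth within reach.
\<close>

section \<open>Finitely supported functions\<close>

lemma l1_norm_finite_support:
  assumes "finite T" "T \<subseteq> X" "\<And>z. z \<in> X \<Longrightarrow> z \<notin> T \<Longrightarrow> f z = 0"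
  shows "f \<in> l1_space X" and "l1_norm X f = (\<Sum>z\<in>T. \<bar>f z\<bar>)"
proof -
  have "(\<lambda>z. \<bar>f z\<bar>) summable_on X \<longleftrightarrow> (\<lambda>z. \<bar>f z\<bar>) summable_on T"
    by (rule summable_on_cong_neutral) (use assms in auto)
  then show "f \<in> l1_space X"
    unfolding l1_space_def using assms(1) by simp
  have "(\<Sum>\<^sub>\<infinity>z\<in>X. \<bar>f z\<bar>) = (\<Sum>\<^sub>\<infinity>z\<in>T. \<bar>f z\<bar>)"
    by (rule infsum_cong_neutral) (use assms in auto)
  then show "l1_norm X f = (\<Sum>z\<in>T. \<bar>f z\<bar>)"
    unfolding l1_norm_def using assms(1) by simp
qed

section \<open>Uniform distributions on finite sets\<close>

definition uniform_weight :: "'a set \<Rightarrow> 'a \<Rightarrow> real" where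
  "uniform_weight A z = indicator A z / card A"

lemma uniform_weight_nonneg: "0 \<le> uniform_weight A z"
  by (simp add: uniform_weight_def)

lemma uniform_weight_eq_0: "z \<notin> A \<Longrightarrow> uniform_weight A z = 0"
  by (simp add: uniform_weight_def)

lemma sum_uniform_weight:
  assumes "finite T" "A \<subseteq> T" "A \<noteq> {}"
  shows "(\<Sum>z\<in>T. uniform_weight A z) = 1"
proof -
  have "finite A" using assms finite_subset by blast
  then have "card A > 0" using assms by (simp add: card_gt_0_iff)
  moreover have "{z\<in>T. z \<in> A} = A" using assms by blast
  ultimately show ?thesis
    using sum_mult_indicator[OF assms(1), of "\<lambda>_. 1::real" "\<lambda>_. A" "\<lambda>z. z"]
    by (simp add: uniform_weight_def sum_divide_distrib[symmetric])
qed

text \<open>Two uniform distributions share at least the mass \<open>card C / card D\<close>, since both are at least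
  \<open>1 / card D\<close> on \<open>C\<close>. The bound \<open>1 - t \<le> - ln t\<close> then turns the lost mass into a difference of
  logarithms, which can be telescoped.\<close>

lemma uniform_weight_diff_le_ln:
  assumes fin: "finite T" "finite D" and sub: "A \<subseteq> T" "B \<subseteq> T" "A \<subseteq> D" "B \<subseteq> D"
    and C: "C \<subseteq> A" "C \<subseteq> B" "C \<noteq> {}"
  shows "(\<Sum>z\<in>T. \<bar>uniform_weight A z - uniform_weight B z\<bar>)
           \<le> 2 * (ln (card D) - ln (card C))"
proof -
  have finAB: "finite A" "finite B"
    using fin sub by (auto intro: finite_subset)
  then have finABC: "finite A" "finite B" "finite C"
    using C(1) by (auto intro: finite_subset)
  have neAB: "A \<noteq> {}" "B \<noteq> {}" "D \<noteq> {}" using C sub by auto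
  have pos: "card A > 0" "card B > 0" "card C > 0" "card D > 0"
    using finABC neAB C fin by (auto simp: card_gt_0_iff)
  have leD: "card A \<le> card D" "card B \<le> card D"
    using sub fin by (auto intro: card_mono)
  have common: "1 / card D \<le> min (uniform_weight A z) (uniform_weight B z)" if "z \<in> C" for z
  proof -
    have "z \<in> A" "z \<in> B" using that C by auto
    then show ?thesis
      using pos leD by (simp add: uniform_weight_def frac_le)
  qed
  have "card C / card D = (\<Sum>z\<in>C. 1 / card D)"
    by simp
  also have "\<dots> \<le> (\<Sum>z\<in>C. min (uniform_weight A z) (uniform_weight B z))"
    by (intro sum_mono common)
  also have "\<dots> \<le> (\<Sum>z\<in>T. min (uniform_weight A z) (uniform_weight B z))"
    by (rule sum_mono2) (use fin C sub in \<open>auto simp: uniform_weight_nonneg\<close>)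
  finally have mass: "card C / card D \<le> (\<Sum>z\<in>T. min (uniform_weight A z) (uniform_weight B z))" .
  have "(\<Sum>z\<in>T. \<bar>uniform_weight A z - uniform_weight B z\<bar>)
      = (\<Sum>z\<in>T. uniform_weight A z + uniform_weight B z
           - 2 * min (uniform_weight A z) (uniform_weight B z))"
    by (intro sum.cong) auto
  also have "\<dots> = 2 - 2 * (\<Sum>z\<in>T. min (uniform_weight A z) (uniform_weight B z))"
    using sum_uniform_weight[OF fin(1) sub(1) neAB(1)] sum_uniform_weight[OF fin(1) sub(2) neAB(2)]
    by (simp add: sum_subtractf sum.distrib sum_distrib_left)
  also have "\<dots> \<le> 2 * (1 - card C / card D)"
    using mass by simp
  also have "\<dots> \<le> 2 * (- ln (card C / card D))"
    using ln_le_minus_one[of "card C / card D"] pos by simp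
  also have "\<dots> = 2 * (ln (card D) - ln (card C))"
    using pos by (simp add: ln_div)
  finally show ?thesis .
qed

section \<open>Averaging along a decreasing family of sets\<close>

lemma sum_diff_shift_le:
  fixes f :: "nat \<Rightarrow> real"
  assumes "\<And>k. 0 \<le> f k" "\<And>k. f k \<le> L"
  shows "(\<Sum>k\<in>{a..<b}. f k - f (k + d)) \<le> d * L"
proof (cases "a \<le> b")
  case True
  have "(\<Sum>k\<in>{a..<b}. f (k + d)) = (\<Sum>k\<in>{a+d..<b+d}. f k)"
    by (simp add: sum.shift_bounds_nat_ivl)
  moreover have "(\<Sum>k\<in>{a..<b}. f k) + (\<Sum>k\<in>{b..<b+d}. f k)
      = (\<Sum>k\<in>{a..<a+d}. f k) + (\<Sum>k\<in>{a+d..<b+d}. f k)"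
    using True by (simp add: sum.atLeastLessThan_concat)
  moreover have "(\<Sum>k\<in>{b..<b+d}. f k) \<ge> 0"
    by (simp add: sum_nonneg assms)
  moreover have "(\<Sum>k\<in>{a..<a+d}. f k) \<le> d * L"
    using sum_bounded_above[of "{a..<a+d}" f L] assms by simp
  ultimately show ?thesis
    by (simp add: sum_subtractf)
next
  case False
  have "0 \<le> L" using assms order_trans by blast
  with False show ?thesis by simp
qed

definition averaged_weight :: "nat \<Rightarrow> (nat \<Rightarrow> 'a set) \<Rightarrow> 'a \<Rightarrow> real" where
  "averaged_weight n P z = (\<Sum>\<rho>\<in>{n..<2*n}. uniform_weight (P \<rho>) z) / n"

lemma averaged_weight_nonneg: "0 \<le> averaged_weight n P z"
  by (simp add: averaged_weight_def sum_nonneg uniform_weight_nonneg)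

lemma averaged_weight_eq_0: "(\<And>\<rho>. z \<notin> P \<rho>) \<Longrightarrow> averaged_weight n P z = 0"
  by (simp add: averaged_weight_def uniform_weight_eq_0)

lemma sum_averaged_weight:
  assumes "n > 0" "finite T" "\<And>\<rho>. P \<rho> \<subseteq> T" "\<And>\<rho>. \<rho> \<le> 2 * n \<Longrightarrow> P \<rho> \<noteq> {}"
  shows "(\<Sum>z\<in>T. averaged_weight n P z) = 1"
proof -
  have "(\<Sum>z\<in>T. averaged_weight n P z)
      = (\<Sum>\<rho>\<in>{n..<2*n}. \<Sum>z\<in>T. uniform_weight (P \<rho>) z) / n"
    unfolding averaged_weight_def sum_divide_distrib[symmetric] by (subst sum.swap) simp
  also have "\<dots> = (\<Sum>\<rho>\<in>{n..<2*n}. 1) / n"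
    using assms by (intro arg_cong2[of _ _ _ _ "(/)"] sum.cong sum_uniform_weight) auto
  also have "\<dots> = 1" using assms(1) by simp
  finally show ?thesis .
qed

text \<open>The averaging window starts at \<open>n\<close> and the sets are nonempty up to \<open>3 * n\<close>, which leaves
  room to move the index by \<open>r \<le> n\<close> in both directions without leaving the range where the
  sandwich bound applies.\<close>

lemma averaged_weight_diff_le:
  fixes P Q :: "nat \<Rightarrow> 'a set"
  assumes n: "n > 0" and r: "r \<le> n" and T: "finite T" "\<And>\<rho>. P \<rho> \<subseteq> T" "\<And>\<rho>. Q \<rho> \<subseteq> T"
    and ne: "\<And>\<rho>. \<rho> \<le> 3 * n \<Longrightarrow> P \<rho> \<noteq> {}" and m: "\<And>\<rho>. card (P \<rho>) \<le> m"
    and anti: "\<And>\<rho> \<sigma>. \<rho> \<le> \<sigma> \<Longrightarrow> P \<sigma> \<subseteq> P \<rho>"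
    and PQ: "\<And>\<rho>. P (\<rho> + r) \<subseteq> Q \<rho>" and QP: "\<And>\<rho>. Q (\<rho> + r) \<subseteq> P \<rho>"
  shows "(\<Sum>z\<in>T. \<bar>averaged_weight n P z - averaged_weight n Q z\<bar>) \<le> 4 * real r * ln m / n"
proof -
  have finP: "finite (P \<rho>)" for \<rho> using T finite_subset by blast
  define f where "f \<rho> = ln (card (P \<rho>))" for \<rho>
  have f0: "0 \<le> f \<rho>" for \<rho>
    \<comment> \<open>An empty set contributes \<open>ln 0 = 0\<close>.\<close>
    unfolding f_def by (cases "card (P \<rho>)") auto
  have fm: "f \<rho> \<le> ln m" for \<rho>
  proof (cases "card (P \<rho>) = 0")
    case True
    have "card (P 0) > 0" using ne[of 0] finP by (simp add: card_gt_0_iff)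
    then have "m \<ge> 1" using m[of 0] by linarith
    then show ?thesis using True by (simp add: f_def)
  next
    case False
    then show ?thesis using m[of \<rho>] by (simp add: f_def)
  qed
  have "(\<Sum>z\<in>T. \<bar>averaged_weight n P z - averaged_weight n Q z\<bar>)
      = (\<Sum>z\<in>T. \<bar>\<Sum>\<rho>\<in>{n..<2*n}. uniform_weight (P \<rho>) z - uniform_weight (Q \<rho>) z\<bar>) / n"
    by (simp add: averaged_weight_def diff_divide_distrib[symmetric] sum_subtractf
        sum_divide_distrib[symmetric])
  also have "\<dots> \<le> (\<Sum>z\<in>T. \<Sum>\<rho>\<in>{n..<2*n}. \<bar>uniform_weight (P \<rho>) z - uniform_weight (Q \<rho>) z\<bar>) / n"
    by (intro divide_right_mono sum_mono sum_abs) simp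
  also have "\<dots> = (\<Sum>\<rho>\<in>{n..<2*n}. \<Sum>z\<in>T. \<bar>uniform_weight (P \<rho>) z - uniform_weight (Q \<rho>) z\<bar>) / n"
    by (subst sum.swap) simp
  also have "\<dots> \<le> (\<Sum>\<rho>\<in>{n..<2*n}. 2 * (f (\<rho> - r) - f (\<rho> + r))) / n"
  proof (intro divide_right_mono sum_mono)
    fix \<rho> assume \<rho>: "\<rho> \<in> {n..<2*n}"
    have "Q \<rho> \<subseteq> P (\<rho> - r)"
      using QP[of "\<rho> - r"] \<rho> r by simp
    then show "(\<Sum>z\<in>T. \<bar>uniform_weight (P \<rho>) z - uniform_weight (Q \<rho>) z\<bar>)
        \<le> 2 * (f (\<rho> - r) - f (\<rho> + r))"
      unfolding f_def
      by (intro uniform_weight_diff_le_ln) (use T finP anti PQ ne \<rho> r in auto)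
  qed simp
  also have "(\<Sum>\<rho>\<in>{n..<2*n}. 2 * (f (\<rho> - r) - f (\<rho> + r)))
      = 2 * (\<Sum>k\<in>{n-r..<2*n-r}. f k - f (k + 2 * r))"
  proof -
    have "(\<Sum>\<rho>\<in>{n-r+r..<2*n-r+r}. f (\<rho> - r) - f (\<rho> + r))
        = (\<Sum>k\<in>{n-r..<2*n-r}. f k - f (k + 2 * r))"
      by (subst sum.shift_bounds_nat_ivl) (simp add: mult_2 add.assoc)
    then show ?thesis using r unfolding sum_distrib_left[symmetric] by simp
  qed
  also have "\<dots> / n \<le> 2 * (real (2 * r) * ln m) / n"
    using sum_diff_shift_le[where f = f and L = "ln m" and d = "2*r" and a = "n-r" and b = "2*n-r"] f0 fm
    by (intro divide_right_mono mult_left_mono) auto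
  finally show ?thesis by simp
qed

section \<open>Marked points of a cover\<close>

lemma card_members_containing_le:
  assumes "multiplicity_cover \<U> = enat m"
  shows "finite {U\<in>\<U>. x \<in> U} \<and> card {U\<in>\<U>. x \<in> U} \<le> m"
proof (rule finite_if_finite_subsets_card_bdd)
  fix \<V> assume "\<V> \<subseteq> {U\<in>\<U>. x \<in> U}" "finite \<V>"
  then have "\<V> \<subseteq> \<U> \<and> finite \<V> \<and> \<Inter>\<V> \<noteq> {}" by blast
  then have "enat (card \<V>) \<le> multiplicity_cover \<U>"
    unfolding multiplicity_cover_def by (intro Sup_upper) blast
  then show "card \<V> \<le> m" using assms by simp
qed

text \<open>The Lebesgue number is a supremum that may not be attained, hence the strict inequality
  between the diameter bound \<open>2 * s\<close> and \<open>t\<close>.\<close>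

lemma ball_in_member:
  assumes "lebesgue_number X \<U> \<ge> ennreal t" "2 * s < t" "0 \<le> s"
  shows "\<exists>U\<in>\<U>. X \<inter> cball x s \<subseteq> U"
proof -
  have "ennreal (2 * s) < lebesgue_number X \<U>"
  proof (rule less_le_trans[OF _ assms(1)])
    show "ennreal (2 * s) < ennreal t" using assms(2,3) by (intro ennreal_lessI) auto
  qed
  then obtain v where "v \<in> {ennreal u | u. u \<ge> 0 \<and>
      (\<forall>B. B \<subseteq> X \<and> bounded B \<and> diameter B \<le> u \<longrightarrow> (\<exists>U\<in>\<U>. B \<subseteq> U))}" "ennreal (2 * s) < v"
    unfolding lebesgue_number_def less_Sup_iff by (elim bexE)
  then obtain u where u: "u \<ge> 0" "ennreal (2 * s) < ennreal u"
    and sub: "\<And>B. B \<subseteq> X \<Longrightarrow> bounded B \<Longrightarrow> diameter B \<le> u \<Longrightarrow> \<exists>U\<in>\<U>. B \<subseteq> U"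
    by auto
  have "2 * s < u" using u assms(3) by (simp add: ennreal_less_iff)
  moreover have "diameter (X \<inter> cball x s) \<le> 2 * s"
  proof -
    have "dist y z \<le> 2 * s" if "y \<in> X \<inter> cball x s" "z \<in> X \<inter> cball x s" for y z
      using that dist_triangle3[of y z x] by simp
    then show ?thesis
      using assms(3) by (auto simp: diameter_def intro!: cSUP_least)
  qed
  moreover have "bounded (X \<inter> cball x s)"
    by (meson bounded_cball bounded_subset inf_le2)
  ultimately show ?thesis by (intro sub) auto
qed

text \<open>Passing from members to marked points preserves the inclusions between subfamilies. Only
  these inclusions, nonemptiness and an upper bound on the cardinality enter the averaging
  argument, so distinct members may share a marked point.\<close>

definition marked_points :: "'a::metric_space set \<Rightarrow> 'a set set \<Rightarrow> nat \<Rightarrow> 'a \<Rightarrow> 'a set" where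
  "marked_points X \<U> \<rho> x = (\<lambda>U. SOME z. z \<in> U) ` {U\<in>\<U>. X \<inter> cball x (real \<rho>) \<subseteq> U}"

lemma marked_points_shift:
  assumes "dist x y \<le> real r"
  shows "marked_points X \<U> (\<rho> + r) x \<subseteq> marked_points X \<U> \<rho> y"
proof -
  have "cball y (real \<rho>) \<subseteq> cball x (real (\<rho> + r))"
    using assms dist_triangle[of x _ y] by (force intro: order_trans)
  then show ?thesis
    unfolding marked_points_def by blast
qed

lemma marked_points_antimono:
  "\<rho> \<le> \<sigma> \<Longrightarrow> marked_points X \<U> \<sigma> x \<subseteq> marked_points X \<U> \<rho> x"
  using marked_points_shift[of x x "\<sigma> - \<rho>" X \<U> \<rho>] by simp

lemma marked_points_near:
  assumes "x \<in> X" "z \<in> marked_points X \<U> \<rho> x"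
  obtains U where "U \<in> \<U>" "x \<in> U" "z \<in> U"
proof -
  obtain U where U: "U \<in> \<U>" "X \<inter> cball x (real \<rho>) \<subseteq> U" "z = (SOME z. z \<in> U)"
    using assms(2) unfolding marked_points_def by blast
  have "x \<in> U" using U assms(1) by auto
  then show thesis using U that someI[of "\<lambda>z. z \<in> U" x] by blast
qed

lemma card_marked_points_le:
  assumes "multiplicity_cover \<U> = enat m" "x \<in> X"
  shows "finite (marked_points X \<U> \<rho> x)" "card (marked_points X \<U> \<rho> x) \<le> m"
proof -
  let ?F = "{U\<in>\<U>. X \<inter> cball x (real \<rho>) \<subseteq> U}"
  have sub: "?F \<subseteq> {U\<in>\<U>. x \<in> U}" using assms(2) by auto
  have fin: "finite {U\<in>\<U>. x \<in> U}" and le: "card {U\<in>\<U>. x \<in> U} \<le> m"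
    using card_members_containing_le[OF assms(1)] by blast+
  have finF: "finite ?F" using sub fin by (rule finite_subset)
  then show "finite (marked_points X \<U> \<rho> x)"
    by (simp add: marked_points_def)
  have "card (marked_points X \<U> \<rho> x) \<le> card ?F"
    unfolding marked_points_def by (rule card_image_le[OF finF])
  also have "\<dots> \<le> m" using card_mono[OF fin sub] le by simp
  finally show "card (marked_points X \<U> \<rho> x) \<le> m" .
qed

section \<open>From covers to property A\<close>

lemma probability_family_of_cover:
  fixes X :: "'a::metric_space set" and n :: nat
  assumes cov: "unif_bounded_cover X \<U>" and leb: "lebesgue_number X \<U> \<ge> ennreal t"
    and t: "6 * real n < t" and n: "n > 0" and mult: "multiplicity_cover \<U> = enat m"
  shows "\<exists>\<zeta>. (\<forall>x\<in>X. \<zeta> x \<in> l1_space X \<and> (\<forall>z\<in>X. \<zeta> x z \<ge> 0) \<and> l1_norm X (\<zeta> x) = 1) \<and>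
     (\<exists>S>0. \<forall>x\<in>X. {z\<in>X. \<zeta> x z \<noteq> 0} \<subseteq> cball x S) \<and>
     (\<forall>r\<le>n. \<forall>x\<in>X. \<forall>y\<in>X. dist x y \<le> real r \<longrightarrow>
        l1_norm X (\<lambda>z. \<zeta> x z - \<zeta> y z) \<le> 4 * real r * ln m / n)"
proof -
  define H where "H x \<rho> = marked_points X \<U> \<rho> x" for x \<rho>
  define \<zeta> where "\<zeta> x = averaged_weight n (H x)" for x
  have H0: "H x \<rho> \<subseteq> H x 0" for x \<rho>
    unfolding H_def by (rule marked_points_antimono) simp
  have finH: "finite (H x \<rho>)" and cardH: "card (H x \<rho>) \<le> m" if "x \<in> X" for x \<rho>
    using card_marked_points_le[OF mult that] by (auto simp: H_def)
  have HX: "H x \<rho> \<subseteq> X" if x: "x \<in> X" for x \<rho>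
  proof
    fix z assume "z \<in> H x \<rho>"
    then have "z \<in> marked_points X \<U> \<rho> x" by (simp add: H_def)
    with x obtain U where "U \<in> \<U>" "x \<in> U" "z \<in> U" by (rule marked_points_near)
    then show "z \<in> X" using cov by (auto simp: unif_bounded_cover_def)
  qed
  have ne: "H x \<rho> \<noteq> {}" if "\<rho> \<le> 3 * n" for x \<rho>
  proof -
    have "real \<rho> \<le> real (3 * n)" using that by (simp only: of_nat_le_iff)
    then have "2 * real \<rho> < t" using t by simp
    then show ?thesis
      using ball_in_member[OF leb, of "real \<rho>" x] by (auto simp: H_def marked_points_def)
  qed
  have zero: "\<zeta> x z = 0" if "z \<notin> H x 0" for x z
    unfolding \<zeta>_def by (rule averaged_weight_eq_0) (use H0 that in blast)
  have norm: "\<zeta> x \<in> l1_space X" "l1_norm X (\<zeta> x) = 1" if x: "x \<in> X" for x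
  proof -
    note l1 = l1_norm_finite_support[OF finH[OF x] HX[OF x], of 0 "\<zeta> x", OF zero]
    show "\<zeta> x \<in> l1_space X" using l1(1) by blast
    have "l1_norm X (\<zeta> x) = (\<Sum>z\<in>H x 0. \<zeta> x z)"
      using l1(2) by (simp add: \<zeta>_def averaged_weight_nonneg)
    also have "\<dots> = 1"
      unfolding \<zeta>_def by (rule sum_averaged_weight) (use n finH[OF x] H0 ne in auto)
    finally show "l1_norm X (\<zeta> x) = 1" .
  qed
  have supp: "\<exists>S>0. \<forall>x\<in>X. {z\<in>X. \<zeta> x z \<noteq> 0} \<subseteq> cball x S"
  proof -
    have "bdd_above (diameter ` \<U>)" using cov by (simp add: unif_bounded_cover_def)
    then obtain D where D: "\<forall>d\<in>diameter ` \<U>. d \<le> D" by (auto simp only: bdd_above_def)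
    have "dist x z \<le> max D 1" if x: "x \<in> X" and z: "\<zeta> x z \<noteq> 0" for x z
    proof -
      have "z \<in> marked_points X \<U> 0 x" using zero z unfolding H_def by blast
      with x obtain U where U: "U \<in> \<U>" "x \<in> U" "z \<in> U" by (rule marked_points_near)
      then have "bounded U" using cov by (simp add: unif_bounded_cover_def)
      then have "dist x z \<le> diameter U" using U by (intro diameter_bounded_bound)
      also have "\<dots> \<le> D" using D U(1) by blast
      finally show ?thesis by simp
    qed
    then show ?thesis by (intro exI[of _ "max D 1"]) auto
  qed
  have var: "l1_norm X (\<lambda>z. \<zeta> x z - \<zeta> y z) \<le> 4 * real r * ln m / n"
    if r: "r \<le> n" and x: "x \<in> X" and y: "y \<in> X" and d: "dist x y \<le> real r" for r x y
  proof -
    let ?T = "H x 0 \<union> H y 0"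
    have T: "finite ?T" "?T \<subseteq> X" using finH HX x y by auto
    have "l1_norm X (\<lambda>z. \<zeta> x z - \<zeta> y z) = (\<Sum>z\<in>?T. \<bar>\<zeta> x z - \<zeta> y z\<bar>)"
      by (rule l1_norm_finite_support[OF T]) (simp add: zero)
    also have "\<dots> \<le> 4 * real r * ln m / n"
      unfolding \<zeta>_def
    proof (rule averaged_weight_diff_le)
      show "H x (\<rho> + r) \<subseteq> H y \<rho>" for \<rho>
        unfolding H_def using d by (rule marked_points_shift)
      show "H y (\<rho> + r) \<subseteq> H x \<rho>" for \<rho>
        unfolding H_def using d by (intro marked_points_shift) (simp add: dist_commute)
      show "H x \<sigma> \<subseteq> H x \<rho>" if "\<rho> \<le> \<sigma>" for \<rho> \<sigma>
        unfolding H_def using that by (rule marked_points_antimono)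
      show "H x \<rho> \<subseteq> ?T" for \<rho>
        using H0[of x \<rho>] by blast
      show "H y \<rho> \<subseteq> ?T" for \<rho>
        using H0[of y \<rho>] by blast
    qed (use n r T ne cardH[OF x] in auto)
    finally show ?thesis .
  qed
  show ?thesis
    using norm supp var by (intro exI[of _ \<zeta>]) (auto simp: \<zeta>_def averaged_weight_nonneg)
qed

text \<open>A cover of least multiplicity exists because \<^typ>\<open>enat\<close> is well-ordered. Its multiplicity
  exceeds the asymptotic dimension function by one, and this is the quantity whose logarithm the
  growth condition controls.\<close>

lemma optimal_cover:
  assumes "asdim_fun X t < \<infinity>"
  obtains \<U> m where "unif_bounded_cover X \<U>" "lebesgue_number X \<U> \<ge> ennreal t"
    "multiplicity_cover \<U> = enat m" "real_of_ereal (asdim_fun X t) + 1 = real m"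
proof -
  let ?M = "{multiplicity_cover \<U> | \<U>. unif_bounded_cover X \<U> \<and> lebesgue_number X \<U> \<ge> ennreal t}"
  have fin: "Inf ?M \<noteq> \<infinity>"
  proof
    assume "Inf ?M = \<infinity>"
    then have "asdim_fun X t = \<infinity>" unfolding asdim_fun_def by simp
    with assms show False by simp
  qed
  then obtain m where m: "Inf ?M = enat m" by auto
  have "?M \<noteq> {}"
    using fin by (metis Inf_empty top_enat_def)
  then have "Inf ?M \<in> ?M"
    by (auto simp: Inf_enat_def intro: LeastI)
  with m obtain \<U> where "unif_bounded_cover X \<U>" "lebesgue_number X \<U> \<ge> ennreal t"
    "multiplicity_cover \<U> = enat m" by auto
  moreover have "real_of_ereal (asdim_fun X t) + 1 = real m"
    unfolding asdim_fun_def m by (simp add: one_ereal_def)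
  ultimately show thesis by (rule that)
qed

lemma property_A_of_sequence:
  fixes X :: "'a::metric_space set" and \<zeta> :: "nat \<Rightarrow> 'a \<Rightarrow> 'a \<Rightarrow> real"
  assumes prob: "\<And>n x. x \<in> X \<Longrightarrow>
      \<zeta> n x \<in> l1_space X \<and> (\<forall>z\<in>X. \<zeta> n x z \<ge> 0) \<and> l1_norm X (\<zeta> n x) = 1"
    and supp: "\<And>n. \<exists>S>0. \<forall>x\<in>X. {z\<in>X. \<zeta> n x z \<noteq> 0} \<subseteq> cball x S"
    and var: "\<And>R. R > 0 \<Longrightarrow> \<exists>\<epsilon>. \<epsilon> \<longlonglongrightarrow> 0 \<and> (\<forall>\<^sub>F n in sequentially. \<forall>x\<in>X. \<forall>y\<in>X.
      dist x y \<le> R \<longrightarrow> l1_norm X (\<lambda>z. \<zeta> n x z - \<zeta> n y z) \<le> \<epsilon> n)"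
  shows "property_A X"
proof -
  define le where "le = {(i, j). i \<le> (j::nat)}"
  have dir: "directed_by UNIV le"
    unfolding directed_by_def preorder_on_def le_def refl_on_def trans_def
    by (auto intro: max.cobounded1 max.cobounded2)
  have "eventually P (net_filter UNIV le) \<longleftrightarrow> eventually P sequentially" for P
    unfolding eventually_net_filter[OF dir] by (simp add: le_def eventually_sequentially)
  then have nf: "net_filter UNIV le = sequentially"
    by (rule filter_eqI)
  have "(\<lambda>n. Sup {ennreal (l1_norm X (\<lambda>z. \<zeta> n x z - \<zeta> n y z)) | x y.
          x \<in> X \<and> y \<in> X \<and> dist x y \<le> R}) \<longlonglongrightarrow> 0" if "R > 0" for R
  proof -
    obtain \<epsilon> where \<epsilon>: "\<epsilon> \<longlonglongrightarrow> 0" "\<forall>\<^sub>F n in sequentially. \<forall>x\<in>X. \<forall>y\<in>X.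
      dist x y \<le> R \<longrightarrow> l1_norm X (\<lambda>z. \<zeta> n x z - \<zeta> n y z) \<le> \<epsilon> n"
      using var[OF \<open>R > 0\<close>] by blast
    show ?thesis
    proof (rule tendsto_sandwich[of "\<lambda>_. 0"])
      show "\<forall>\<^sub>F n in sequentially. Sup {ennreal (l1_norm X (\<lambda>z. \<zeta> n x z - \<zeta> n y z)) | x y.
          x \<in> X \<and> y \<in> X \<and> dist x y \<le> R} \<le> ennreal (\<epsilon> n)"
        using \<epsilon>(2) by eventually_elim (auto intro!: Sup_least ennreal_leI)
      show "(\<lambda>n. ennreal (\<epsilon> n)) \<longlonglongrightarrow> 0"
        using tendsto_ennrealI[OF \<epsilon>(1)] by simp
    qed auto
  qed
  then have "property_A_net X UNIV le \<zeta>"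
    unfolding property_A_net_def nf using dir prob supp by blast
  then show ?thesis unfolding property_A_def by blast
qed

theorem theorem1:
  fixes X :: "'a::metric_space set"
  assumes "subexponential_growth (asdim_fun X)"
  shows "property_A X"
proof -
  define g where "g t = ln (real_of_ereal (asdim_fun X t) + 1)" for t
  have fin: "asdim_fun X t < \<infinity>" if "t \<ge> 0" for t
    using assms that by (simp add: subexponential_growth_def)
  have lim: "((\<lambda>t. 1 / t * g t) \<longlongrightarrow> 0) at_top"
    using assms by (simp add: subexponential_growth_def g_def)
  \<comment> \<open>The window length is \<open>Suc n\<close>, which is never zero, and covers are taken at the scale
    \<open>7 * Suc n\<close> in order to exceed the required \<open>6 * Suc n\<close> strictly.\<close>
  define good where "good n \<zeta> \<longleftrightarrow>
     (\<forall>x\<in>X. \<zeta> x \<in> l1_space X \<and> (\<forall>z\<in>X. \<zeta> x z \<ge> 0) \<and> l1_norm X (\<zeta> x) = 1) \<and>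
     (\<exists>S>0. \<forall>x\<in>X. {z\<in>X. \<zeta> x z \<noteq> 0} \<subseteq> cball x S) \<and>
     (\<forall>r\<le>Suc n. \<forall>x\<in>X. \<forall>y\<in>X. dist x y \<le> real r \<longrightarrow>
        l1_norm X (\<lambda>z. \<zeta> x z - \<zeta> y z) \<le> 4 * real r * g (7 * real (Suc n)) / Suc n)" for n \<zeta>
  have "\<exists>\<zeta>. good n \<zeta>" for n
  proof -
    obtain \<U> m where \<U>: "unif_bounded_cover X \<U>"
      "lebesgue_number X \<U> \<ge> ennreal (7 * real (Suc n))" "multiplicity_cover \<U> = enat m"
      and m: "real_of_ereal (asdim_fun X (7 * real (Suc n))) + 1 = real m"
      by (rule optimal_cover[OF fin[of "7 * real (Suc n)"]]) auto
    show ?thesis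
      unfolding good_def g_def m
      by (rule probability_family_of_cover[OF \<U>(1,2) _ _ \<U>(3)]) auto
  qed
  then obtain \<zeta> where good: "good n (\<zeta> n)" for n
    by metis
  have prob: "\<zeta> n x \<in> l1_space X \<and> (\<forall>z\<in>X. \<zeta> n x z \<ge> 0) \<and> l1_norm X (\<zeta> n x) = 1"
    if "x \<in> X" for n x
    using good[of n] that unfolding good_def by blast
  have supp: "\<exists>S>0. \<forall>x\<in>X. {z\<in>X. \<zeta> n x z \<noteq> 0} \<subseteq> cball x S" for n
    using good[of n] unfolding good_def by (elim conjE)
  have var: "l1_norm X (\<lambda>z. \<zeta> n x z - \<zeta> n y z) \<le> 4 * real r * g (7 * real (Suc n)) / Suc n"
    if "r \<le> Suc n" "x \<in> X" "y \<in> X" "dist x y \<le> real r" for n r x y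
    using good[of n] that unfolding good_def by (elim conjE) simp
  show ?thesis
  proof (rule property_A_of_sequence[OF prob supp])
    fix R :: real
    define r where "r = nat \<lceil>R\<rceil>"
    define \<epsilon> where "\<epsilon> n = 4 * real r * g (7 * real (Suc n)) / Suc n" for n
    have "filterlim (\<lambda>n. 7 * real (Suc n)) at_top sequentially"
      by (intro filterlim_tendsto_pos_mult_at_top[OF tendsto_const]
          filterlim_compose[OF filterlim_real_sequentially] filterlim_Suc) simp
    from filterlim_compose[OF lim this]
    have "(\<lambda>n. 28 * real r * (1 / (7 * real (Suc n)) * g (7 * real (Suc n)))) \<longlonglongrightarrow> 0"
      by (rule tendsto_mult_right_zero)
    moreover have "28 * real r * (1 / (7 * real (Suc n)) * g (7 * real (Suc n))) = \<epsilon> n" for n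
      unfolding \<epsilon>_def by (simp add: field_simps del: of_nat_Suc)
    ultimately have "\<epsilon> \<longlonglongrightarrow> 0" by simp
    moreover have "\<forall>\<^sub>F n in sequentially. \<forall>x\<in>X. \<forall>y\<in>X. dist x y \<le> R \<longrightarrow>
        l1_norm X (\<lambda>z. \<zeta> n x z - \<zeta> n y z) \<le> \<epsilon> n"
      using eventually_ge_at_top[of r]
    proof eventually_elim
      case (elim n)
      have "R \<le> real r" unfolding r_def by (rule real_nat_ceiling_ge)
      with elim show ?case unfolding \<epsilon>_def by (intro ballI impI var) auto
    qed
    ultimately show "\<exists>\<epsilon>. \<epsilon> \<longlonglongrightarrow> 0 \<and> (\<forall>\<^sub>F n in sequentially. \<forall>x\<in>X. \<forall>y\<in>X.
        dist x y \<le> R \<longrightarrow> l1_norm X (\<lambda>z. \<zeta> n x z - \<zeta> n y z) \<le> \<epsilon> n)"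
      by blast
  qed
qed

end
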